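(* Let $A$ and $D$ be invertible complex matrices of sizes $n\times n$ and $m\times m$ respectively, and let $B$ and $C$ be complex matrices of sizes $n\times m$ and $m\times n$ respectively. Suppose that the block matrix $M=\begin{pmatrix}A & B\\ C & D\end{pmatrix}$ is invertible (so that $A-BD^{-1}C$ and $D-CA^{-1}B$ are invertible). Then the $(n+m)\times(n+m)$ matrix $$P=\begin{pmatrix}A(A-BD^{-1}C)^{-1} & -B(D-CA^{-1}B)^{-1}\\ C(A-BD^{-1}C)^{-1} & -CA^{-1}B(D-CA^{-1}B)^{-1} \end{pmatrix}$$ is idempotent, i.e. $P^2=P$.
   Context: A square matrix $P$ is called idempotent if $P^2=P$. *)

theory Defs
  imports "Jordan_Normal_Form.Gauss_Jordan_Elimination" Complex_Main
begin

text \<open>The library inverse is option-valued; for an invertible matrix it is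
  \<^term>\<open>Some\<close> of the two-sided inverse, and for a non-invertible one the
  value below is unspecified.\<close>

definition mat_inv :: "'a :: field mat \<Rightarrow> 'a mat" where
  "mat_inv A = the (mat_inverse A)"

definition idempotent_mat :: "'a :: semiring_1 mat \<Rightarrow> bool" where
  "idempotent_mat P \<longleftrightarrow> square_mat P \<and> P ^\<^sub>m 2 = P"

end

theory Submission
  imports Defs "Jordan_Normal_Form.Determinant"
begin

text \<open>The matrix $P$ is $M E M^{-1}$, where $E$ is the block-diagonal projection with blocks
  $1$ and $0$: the diagonal blocks of $M^{-1}$ are the inverses of the Schur complements, and
  its upper right block $Y$ satisfies $A Y = - B (D - C A^{-1} B)^{-1}$. So $P$ is a conjugate
  of an idempotent.\<close>

text \<open>For square matrices over a field a right inverse is also a left inverse, so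
  \<open>A\<close> is a unit of the matrix ring. This excludes the value \<open>None\<close> of
  \<open>mat_inverse\<close>, and uniqueness of the two-sided inverse identifies its value with
  \<open>X\<close>.\<close>

lemma mat_inv_eqI:
  fixes A :: "'a :: field mat"
  assumes A: "A \<in> carrier_mat n n" and X: "X \<in> carrier_mat n n" and AX: "A * X = 1\<^sub>m n"
  shows "invertible_mat A" and "mat_inv A = X"
proof -
  have XA: "X * A = 1\<^sub>m n" by (rule mat_mult_left_right_inverse[OF A X AX])
  show "invertible_mat A"
    unfolding invertible_mat_def inverts_mat_def using A X AX XA by auto
  have "A \<in> Units (ring_mat TYPE('a) n ())"
    unfolding Units_def ring_mat_def using A X AX XA by auto
  then obtain Y where Y: "mat_inverse A = Some Y"
    using mat_inverse(1)[OF A, of "()"] by (cases "mat_inverse A") auto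
  from mat_inverse(2)[OF A Y] have AY: "A * Y = 1\<^sub>m n" and Yc: "Y \<in> carrier_mat n n" by auto
  have "Y = (X * A) * Y" using Yc by (simp add: XA)
  also have "\<dots> = X * (A * Y)" by (rule assoc_mult_mat[OF X A Yc])
  also have "\<dots> = X" using X by (simp add: AY)
  finally show "mat_inv A = X" unfolding mat_inv_def Y by simp
qed

lemma invertible_mat_obtain:
  fixes A :: "'a :: field mat"
  assumes A: "A \<in> carrier_mat n n" and inv: "invertible_mat A"
  obtains X where "X \<in> carrier_mat n n" "A * X = 1\<^sub>m n" "X * A = 1\<^sub>m n"
proof -
  obtain X where AX: "A * X = 1\<^sub>m n" and XA: "X * A = 1\<^sub>m (dim_row X)"
    using inv A unfolding invertible_mat_def inverts_mat_def by auto
  \<comment> \<open>\<open>inverts_mat\<close> does not prescribe the size of \<open>X\<close>; it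
    is recovered by comparing the numbers of columns in the two product equations.\<close>
  have "dim_col X = n" using arg_cong[OF AX, of dim_col] by simp
  moreover have "dim_row X = n" using arg_cong[OF XA, of dim_col] A by simp
  ultimately show thesis using that[of X] AX XA by auto
qed

lemma mat_inv_inverts:
  fixes A :: "'a :: field mat"
  assumes A: "A \<in> carrier_mat n n" and inv: "invertible_mat A"
  shows "mat_inv A \<in> carrier_mat n n" and "A * mat_inv A = 1\<^sub>m n" and "mat_inv A * A = 1\<^sub>m n"
proof -
  obtain X where X: "X \<in> carrier_mat n n" "A * X = 1\<^sub>m n" "X * A = 1\<^sub>m n"
    by (rule invertible_mat_obtain[OF A inv])
  with mat_inv_eqI(2)[OF A X(1,2)]
  show "mat_inv A \<in> carrier_mat n n" "A * mat_inv A = 1\<^sub>m n" "mat_inv A * A = 1\<^sub>m n"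
    by simp_all
qed

text \<open>Once the block sizes are fixed, \<open>split_block\<close> is a left inverse of
  \<open>four_block_mat\<close>. This turns one equation between block matrices into four.\<close>

lemma four_block_mat_inject:
  assumes "A \<in> carrier_mat nr1 nc1" "B \<in> carrier_mat nr1 nc2"
    "C \<in> carrier_mat nr2 nc1" "D \<in> carrier_mat nr2 nc2"
    "A' \<in> carrier_mat nr1 nc1" "B' \<in> carrier_mat nr1 nc2"
    "C' \<in> carrier_mat nr2 nc1" "D' \<in> carrier_mat nr2 nc2"
    and eq: "four_block_mat A B C D = four_block_mat A' B' C' D'"
  shows "A = A'" and "B = B'" and "C = C'" and "D = D'"
proof -
  have blocks: "split_block (four_block_mat A B C D) nr1 nc1 = (A, B, C, D)"
    if "A \<in> carrier_mat nr1 nc1" "B \<in> carrier_mat nr1 nc2"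
      "C \<in> carrier_mat nr2 nc1" "D \<in> carrier_mat nr2 nc2" for A B C D :: "'a mat"
    using that unfolding split_block_def Let_def by (auto intro!: eq_matI)
  have "(A, B, C, D) = (A', B', C', D')"
    unfolding blocks[OF assms(1-4), symmetric] blocks[OF assms(5-8), symmetric] eq ..
  then show "A = A'" "B = B'" "C = C'" "D = D'" by auto
qed

lemma add_mat_eq_zero_imp:
  fixes A B :: "'a :: ab_group_add mat"
  assumes A: "A \<in> carrier_mat nr nc" and B: "B \<in> carrier_mat nr nc"
    and eq: "A + B = 0\<^sub>m nr nc"
  shows "A = - B"
proof (rule eq_matI)
  fix i j assume "i < dim_row (- B)" "j < dim_col (- B)"
  with arg_cong[OF eq, of "\<lambda>M. M $$ (i, j)"] A B show "A $$ (i, j) = (- B) $$ (i, j)"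
    by (auto simp: eq_neg_iff_add_eq_0)
qed (use A B in auto)

text \<open>Multiply \<open>F = - (D * Z)\<close> by the inverse of \<open>D\<close> from the left.
  This is the elimination step for the off-diagonal blocks of a product equal to the
  identity.\<close>

lemma mat_inv_mult_eq:
  fixes D :: "'a :: field mat"
  assumes D: "D \<in> carrier_mat m m" "invertible_mat D"
    and Z: "Z \<in> carrier_mat m k" and F: "F \<in> carrier_mat m k"
    and eq: "F + D * Z = 0\<^sub>m m k"
  shows "mat_inv D * F = - Z"
proof -
  note Di = mat_inv_inverts[OF D]
  have "F = - (D * Z)" by (rule add_mat_eq_zero_imp[OF F _ eq]) (use D Z in auto)
  then have "mat_inv D * F = - (mat_inv D * (D * Z))" using Di(1) D Z by simp
  also have "mat_inv D * (D * Z) = Z"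
    using assoc_mult_mat[OF Di(1) D(1) Z, symmetric] Z by (simp add: Di)
  finally show ?thesis .
qed

text \<open>$X$ and $Z$ are the blocks of the first block column of the inverse of the
  block matrix with rows $(A, B)$ and $(C, D)$.\<close>
lemma schur_complement_inverse:
  fixes A :: "'a :: field mat"
  assumes A: "A \<in> carrier_mat n n" and B: "B \<in> carrier_mat n m"
    and C: "C \<in> carrier_mat m n" and D: "D \<in> carrier_mat m m" "invertible_mat D"
    and X: "X \<in> carrier_mat n n" and Z: "Z \<in> carrier_mat m n"
    and one: "A * X + B * Z = 1\<^sub>m n" and zero: "C * X + D * Z = 0\<^sub>m m n"
  shows "invertible_mat (A - B * mat_inv D * C)" and "mat_inv (A - B * mat_inv D * C) = X"
proof -
  note Di = mat_inv_inverts(1)[OF D]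
  have BDi: "B * mat_inv D \<in> carrier_mat n m" using B Di by auto
  have S: "A - B * mat_inv D * C \<in> carrier_mat n n"
    by (rule minus_carrier_mat[OF mult_carrier_mat[OF BDi C]])
  have CX: "C * X \<in> carrier_mat m n" using C X by auto
  \<comment> \<open>The equation \<open>zero\<close> gives \<open>mat_inv D * (C * X) = - Z\<close>,
    so the correction term of the Schur complement contributes exactly the missing
    \<open>B * Z\<close> of the equation \<open>one\<close>.\<close>
  have "(B * mat_inv D * C) * X = B * (mat_inv D * (C * X))"
    using assoc_mult_mat[OF BDi C X] assoc_mult_mat[OF B Di CX] by simp
  also have "\<dots> = - (B * Z)" using mat_inv_mult_eq[OF D Z CX zero] B Z by simp
  finally have BDCX: "(B * mat_inv D * C) * X = - (B * Z)" .
  have "(A - B * mat_inv D * C) * X = A * X - (B * mat_inv D * C) * X"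
    by (rule minus_mult_distrib_mat[OF A mult_carrier_mat[OF BDi C] X])
  also have "\<dots> = A * X + B * Z" unfolding BDCX using A X B Z by (intro eq_matI) auto
  finally have "(A - B * mat_inv D * C) * X = 1\<^sub>m n" using one by simp
  from mat_inv_eqI[OF S X this]
  show "invertible_mat (A - B * mat_inv D * C)" "mat_inv (A - B * mat_inv D * C) = X" .
qed

text \<open>In the square of \<open>M * E * N\<close> the inner factor \<open>N * M\<close> cancels,
  leaving \<open>M * (E * E) * N\<close>.\<close>

lemma idempotent_mat_conjugate:
  fixes M :: "'a :: field mat"
  assumes M: "M \<in> carrier_mat k k" and E: "E \<in> carrier_mat k k" and N: "N \<in> carrier_mat k k"
    and NM: "N * M = 1\<^sub>m k" and EE: "E * E = E"
  shows "idempotent_mat (M * E * N)"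
proof -
  have ME: "M * E \<in> carrier_mat k k" using M E by auto
  have MEN: "M * E * N \<in> carrier_mat k k" using ME N by auto
  have "M * E * N * (M * E * N) = M * E * (N * (M * (E * N)))"
    using M E N by (simp add: assoc_mult_mat[of _ k k _ k _ k])
  also have "N * (M * (E * N)) = N * M * (E * N)"
    using M E N by (simp add: assoc_mult_mat[of _ k k _ k _ k])
  also have "\<dots> = E * N" unfolding NM using E N by simp
  also have "M * E * (E * N) = M * (E * E) * N"
    using M E N by (simp add: assoc_mult_mat[of _ k k _ k _ k])
  finally have "M * E * N * (M * E * N) = M * E * N" unfolding EE .
  then show ?thesis
    unfolding idempotent_mat_def using MEN M N by (simp add: numeral_2_eq_2)
qed

theorem theorem3p1:
  fixes A B C D :: "complex mat" and n m :: nat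
  assumes "A \<in> carrier_mat n n" and "B \<in> carrier_mat n m"
    and "C \<in> carrier_mat m n" and "D \<in> carrier_mat m m"
    and "invertible_mat A" and "invertible_mat D"
    and "invertible_mat (four_block_mat A B C D)"
  shows "invertible_mat (A - B * mat_inv D * C) \<and>
    invertible_mat (D - C * mat_inv A * B) \<and>
    idempotent_mat
      (four_block_mat
        (A * mat_inv (A - B * mat_inv D * C))
        (- (B * mat_inv (D - C * mat_inv A * B)))
        (C * mat_inv (A - B * mat_inv D * C))
        (- (C * mat_inv A * B * mat_inv (D - C * mat_inv A * B))))"
proof -
  note A = assms(1) and B = assms(2) and C = assms(3) and D = assms(4)
  let ?M = "four_block_mat A B C D"
  have M: "?M \<in> carrier_mat (n + m) (n + m)" using A D by simp
  obtain N where N: "N \<in> carrier_mat (n + m) (n + m)"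
    and MN: "?M * N = 1\<^sub>m (n + m)" and NM: "N * ?M = 1\<^sub>m (n + m)"
    by (rule invertible_mat_obtain[OF M assms(7)])
  obtain X Y Z W where split: "split_block N n n = (X, Y, Z, W)" by (metis prod_cases4)
  have dims: "dim_row N = n + m" "dim_col N = n + m" using N by auto
  note blocks = split_block[OF split dims]
  note X = blocks(1) and Y = blocks(2) and Z = blocks(3) and W = blocks(4) and N_eq = blocks(5)
  \<comment> \<open>The equation \<open>?M * N = 1\<close> read blockwise; its four components
    relate \<open>A\<close>, \<open>B\<close>, \<open>C\<close>, \<open>D\<close> to the blocks of
    the inverse.\<close>
  have prod: "four_block_mat (A * X + B * Z) (A * Y + B * W) (C * X + D * Z) (C * Y + D * W)
      = four_block_mat (1\<^sub>m n) (0\<^sub>m n m) (0\<^sub>m m n) (1\<^sub>m m)"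
    using MN unfolding N_eq mult_four_block_mat[OF A B C D X Y Z W] by simp
  have carriers: "A * X + B * Z \<in> carrier_mat n n" "A * Y + B * W \<in> carrier_mat n m"
    "C * X + D * Z \<in> carrier_mat m n" "C * Y + D * W \<in> carrier_mat m m"
    using A B C D X Y Z W by simp_all
  note eqs = four_block_mat_inject[OF carriers one_carrier_mat zero_carrier_mat
      zero_carrier_mat one_carrier_mat prod]
  note S = schur_complement_inverse[OF A B C D assms(6) X Z eqs(1,3)]
  \<comment> \<open>The second block column, with summands swapped so that the Schur complement
    lemma applies again under the exchange of \<open>A\<close> with \<open>D\<close>,
    \<open>B\<close> with \<open>C\<close>, and \<open>X\<close>, \<open>Z\<close> with
    \<open>W\<close>, \<open>Y\<close>.\<close>
  have eqs': "D * W + C * Y = 1\<^sub>m m" "B * W + A * Y = 0\<^sub>m n m"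
    using eqs(2,4) A B C D Y W
    by (simp_all add: comm_add_mat[of "D * W" m m] comm_add_mat[of "B * W" n m])
  note T = schur_complement_inverse[OF D C B A assms(5) W Y eqs']
  have AY: "A * Y = - (B * W)"
    by (rule add_mat_eq_zero_imp[OF _ _ eqs(2)]) (use A B Y W in auto)
  have BW: "B * W \<in> carrier_mat n m" using B W by auto
  note Ai = mat_inv_inverts(1)[OF A assms(5)]
  have CAi: "C * mat_inv A \<in> carrier_mat m n" using C Ai by auto
  \<comment> \<open>The lower right block of the claimed matrix, with \<open>W\<close> for the
    inverse of the second Schur complement: \<open>A * Y + B * W = 0\<close> gives
    \<open>mat_inv A * (B * W) = - Y\<close>.\<close>
  have "C * mat_inv A * B * W = C * (mat_inv A * (B * W))"
    using assoc_mult_mat[OF CAi B W] assoc_mult_mat[OF C Ai BW] by simp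
  also have "\<dots> = - (C * Y)" using mat_inv_mult_eq[OF A assms(5) Y BW eqs'(2)] C Y by simp
  finally have CY: "- (C * mat_inv A * B * W) = C * Y" by simp
  let ?E = "four_block_mat (1\<^sub>m n) (0\<^sub>m n m) (0\<^sub>m m n) (0\<^sub>m m m) :: complex mat"
  have E: "1\<^sub>m n \<in> carrier_mat n n" "0\<^sub>m n m \<in> carrier_mat n m"
    "0\<^sub>m m n \<in> carrier_mat m n" "0\<^sub>m m m \<in> carrier_mat m m" by auto
  have ME: "?M * ?E = four_block_mat A (0\<^sub>m n m) C (0\<^sub>m m m)"
    unfolding mult_four_block_mat[OF A B C D E] using A B C D by simp
  \<comment> \<open>\<open>?E\<close> keeps only the first block column of \<open>?M\<close>, which
    then meets only the first block row \<open>X\<close>, \<open>Y\<close> of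
    \<open>N\<close>.\<close>
  have "?M * ?E * N = four_block_mat (A * X) (A * Y) (C * X) (C * Y)"
    unfolding ME N_eq mult_four_block_mat[OF A E(2) C E(4) X Y Z W]
    using A C X Y Z W by simp
  moreover have "idempotent_mat (?M * ?E * N)"
  proof (rule idempotent_mat_conjugate[OF M _ N NM])
    show "?E \<in> carrier_mat (n + m) (n + m)" by simp
    show "?E * ?E = ?E" unfolding mult_four_block_mat[OF E E] by simp
  qed
  \<comment> \<open>With the inverses of the Schur complements replaced by \<open>X\<close> and
    \<open>W\<close>, the left blocks agree with those of \<open>?M * ?E * N\<close> literally, and
    the right ones by \<open>AY\<close> and \<open>CY\<close>.\<close>
  ultimately show ?thesis unfolding S(2) T(2) using S(1) T(1) by (simp add: AY CY)
qed

end
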